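(* Let $t\ge 2$ and let $v_1,\ldots,v_t$ be integers with $v_i\ge 2$ for all $i$. Define integers $h_t,h_{t-1},\ldots,h_1$ (in this order) by $$h_t=\left\lceil\frac{\log_2(v_t+1)}{\log_2 3}\right\rceil,$$ $$h_i=h_{i+1}+\delta_i,\qquad \delta_i=\min\Big\{\delta\ \Big|\ \sum_{k=1}^{\delta}\binom{h_{i+1}+\delta}{k}2^k\ge v_i\Big\}\qquad(1<i<t),$$ $$h_1=h_2+\delta_1,\qquad \delta_1=\min\Big\{\delta\ \Big|\ \sum_{k=0}^{\delta}\binom{h_2+\delta}{k}3^k\ge v_1\Big\},$$ where the minima are over nonnegative integers $\delta$. Then $$h_1\ \le\ Z_t(v_1,\ldots,v_t)\ \le\ w(\langle v_1,\ldots,v_t\rangle).$$ Therefore the position modulation code with $m=2$ and parameters $h_1,\ldots,h_t$, which is a $\langle v_1,\ldots,v_t\rangle/(2h_1)$ womcode, achieves a rate that is at least half the optimal rate, i.e. $$\frac{\log_2(v_1\cdots v_t)}{2h_1}\ \ge\ \frac12\cdot\frac{\log_2(v_1\cdots v_t)}{w(\langle v_1,\ldots,v_t\rangle)}.$$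
   Context: A write-once memory with $n$ wits has states in $\{0,1\}^n$; it starts in the all-zero state, and each bit can be changed from $0$ to $1$ but never from $1$ to $0$. Write $x\le y$ for the componentwise order on $\{0,1\}^n$. For positive integers $v_1,\ldots,v_t$, a $\langle v_1,\ldots,v_t\rangle/n$ womcode is a code that can write, using $n$ wits, a variable of cardinality $v_1$ the first time, then a variable of cardinality $v_2$ the second time, and so on up to a variable of cardinality $v_t$ the $t$-th time. The decoder sees only the current memory state. Formally, it consists of encoding maps $E_i:\{0,1\}^n\times\{0,\ldots,v_i-1\}\to\{0,1\}^n$ for $1\le i\le t$ and a single decoding map $D$ on $\{0,1\}^n$ with values in the nonnegative integers, such that for every sequence of messages $a_1,\ldots,a_t$ with $a_i\in\{0,\ldots,v_i-1\}$, the states defined by $x^{(0)}=0$ and $x^{(i)}=E_i(x^{(i-1)},a_i)$ satisfy $x^{(i-1)}\le x^{(i)}$ and $D(x^{(i)})=a_i$ for all $i=1,\ldots,t$. The rate of a $\langle v_1,\ldots,v_t\rangle/n$ womcode is $\log_2(v_1\cdots v_t)/n$. $w(\langle v_1,\ldots,v_t\rangle)$ denotes the least $n$ for which a $\langle v_1,\ldots,v_t\rangle/n$ womcode exists; the optimal rate is $\log_2(v_1\cdots v_t)/w(\langle v_1,\ldots,v_t\rangle)$. The functions $Z_t$ are defined recursively by $Z_0=0$ and, for $t\ge1$, $$Z_t(v_1,\ldots,v_t)=Z_{t-1}(v_2,\ldots,v_t)+\delta\big(v_1,Z_{t-1}(v_2,\ldots,v_t)\big),$$ where for integers $v\ge1$,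 $q\ge0$, $$\delta(v,q)=\min\Big\{\delta\ge0\ \Big|\ \sum_{i=0}^{\delta}\binom{q+\delta}{i}\ge v\Big\}.$$ The position modulation code with $m=2$ and parameters $h_1>\cdots>h_t>0$ uses $n=2h_1$ wits, organized as $h_1$ symbols of two wits each, with values in $\{0,1,2,3\}$ (the value $3$, i.e. both wits equal to $1$, is the "erased" value). First write: choose between $0$ and $h_1-h_2$ symbols and set each to a value in $\{1,2,3\}$. $i$-th write, $1<i<t$: set all nonzero symbols (and, if needed, some zero symbols) to the erased value so that exactly $h_i$ zero symbols remain, then choose between $1$ and $h_i-h_{i+1}$ of them and set each to a value in $\{1,2\}$. Last write: erase likewise so that exactly $h_t$ zero symbols remain, and set these to a vector in $\{0,1,2\}^{h_t}$ other than the all-zero vector. In each write the message is represented by the resulting choice of positions and values; the decoder recovers the write number from the number of zero symbols. *)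

theory Defs
  imports Complex_Main
begin

text \<open>
  All families indexed by the write number are functions on nat that are only inspected
  on the indices 1, ..., t.
\<close>

definition states :: "nat \<Rightarrow> bool list set" where
  "states n = {x. length x = n}"

definition state_le :: "bool list \<Rightarrow> bool list \<Rightarrow> bool" where
  "state_le x y \<longleftrightarrow> list_all2 (\<le>) x y"

fun written_state ::
  "nat \<Rightarrow> (nat \<Rightarrow> bool list \<Rightarrow> nat \<Rightarrow> bool list) \<Rightarrow> (nat \<Rightarrow> nat) \<Rightarrow> nat \<Rightarrow> bool list"
where
  "written_state n E a 0 = replicate n False"
| "written_state n E a (Suc i) = E (Suc i) (written_state n E a i) (a (Suc i))"

definition womcode ::
  "nat \<Rightarrow> (nat \<Rightarrow> nat) \<Rightarrow> nat \<Rightarrow> (nat \<Rightarrow> bool list \<Rightarrow> nat \<Rightarrow> bool list) \<Rightarrow> (bool list \<Rightarrow> nat) \<Rightarrow> bool"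
where
  "womcode t v n E D \<longleftrightarrow>
     (\<forall>i\<in>{1..t}. \<forall>x\<in>states n. \<forall>a<v i. E i x a \<in> states n) \<and>
     (\<forall>a. (\<forall>i\<in>{1..t}. a i < v i) \<longrightarrow>
        (\<forall>i\<in>{1..t}. state_le (written_state n E a (i - 1)) (written_state n E a i) \<and>
                    D (written_state n E a i) = a i))"

definition wom_w :: "nat \<Rightarrow> (nat \<Rightarrow> nat) \<Rightarrow> nat" where
  "wom_w t v = (LEAST n. \<exists>E D. womcode t v n E D)"

definition wom_rate :: "nat \<Rightarrow> (nat \<Rightarrow> nat) \<Rightarrow> nat \<Rightarrow> real" where
  "wom_rate t v n = log 2 (\<Prod>i=1..t. real (v i)) / real n"

definition wom_optimal_rate :: "nat \<Rightarrow> (nat \<Rightarrow> nat) \<Rightarrow> real" where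
  "wom_optimal_rate t v = wom_rate t v (wom_w t v)"

definition wom_delta :: "nat \<Rightarrow> nat \<Rightarrow> nat" where
  "wom_delta v q = (LEAST d. (\<Sum>i=0..d. (q + d) choose i) \<ge> v)"

text \<open>The recursive call drops the first cardinality: it is applied to v 2, v 3, ....\<close>

fun wom_Z :: "nat \<Rightarrow> (nat \<Rightarrow> nat) \<Rightarrow> nat" where
  "wom_Z 0 v = 0"
| "wom_Z (Suc t) v =
     wom_Z t (\<lambda>i. v (Suc i)) + wom_delta (v 1) (wom_Z t (\<lambda>i. v (Suc i)))"


text \<open>
  Position modulation with two wits per symbol: symbol j consists of the wits 2j and 2j + 1,
  and the value 3 (both wits set) is the erased value.
\<close>

definition symbols :: "bool list \<Rightarrow> nat list" where
  "symbols x = map (\<lambda>j. of_bool (x ! (2 * j)) + 2 * of_bool (x ! (2 * j + 1))) [0..<length x div 2]"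

definition zero_symbols :: "bool list \<Rightarrow> nat set" where
  "zero_symbols x = {j. j < length (symbols x) \<and> symbols x ! j = 0}"

definition num_nonzero :: "nat list \<Rightarrow> nat" where
  "num_nonzero c = length (filter (\<lambda>s. s \<noteq> 0) c)"

text \<open>
  A choice of positions together with values at these positions is encoded as the vector
  carrying these values there and 0 elsewhere.  For i > 1 the vector is indexed, in increasing
  order, by the h i zero symbols remaining after the erasure.
\<close>

definition pm_choices :: "nat \<Rightarrow> (nat \<Rightarrow> nat) \<Rightarrow> nat \<Rightarrow> nat list set" where
  "pm_choices t h i =
     (if i = 1 then
        {c. length c = h 1 \<and> set c \<subseteq> {0, 1, 2, 3} \<and> num_nonzero c \<le> h 1 - h 2}
      else if i < t then
        {c. length c = h i \<and> set c \<subseteq> {0, 1, 2} \<and>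
            1 \<le> num_nonzero c \<and> num_nonzero c \<le> h i - h (i + 1)}
      else
        {c. length c = h t \<and> set c \<subseteq> {0, 1, 2} \<and> c \<noteq> replicate (h t) 0})"

text \<open>
  The state y arises from x by erasing every symbol outside a set S of zero symbols of x and
  then writing the vector c on S.  Which of the zero symbols are erased is left open.
\<close>

definition pm_erase_write :: "bool list \<Rightarrow> nat list \<Rightarrow> bool list \<Rightarrow> bool" where
  "pm_erase_write x c y \<longleftrightarrow>
     length y = length x \<and>
     (\<exists>S\<subseteq>zero_symbols x. card S = length c \<and>
        (\<forall>j<length (symbols y). j \<notin> S \<longrightarrow> symbols y ! j = 3) \<and>
        nths (symbols y) S = c)"

text \<open>
  After write i the number of zero symbols is at least h (i + 1) (if i < t) and, for i > 1,
  less than h i.  For decreasing h, the write number is thus obtained by counting the j > 1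
  for which h j exceeds the number of zero symbols.
\<close>

definition pm_write_number :: "nat \<Rightarrow> (nat \<Rightarrow> nat) \<Rightarrow> bool list \<Rightarrow> nat" where
  "pm_write_number t h x = 1 + card {j\<in>{2..t}. card (zero_symbols x) < h j}"

definition pm_read :: "nat \<Rightarrow> bool list \<Rightarrow> nat list" where
  "pm_read i x = (if i = 1 then symbols x else filter (\<lambda>s. s \<noteq> 3) (symbols x))"

text \<open>
  The code depends on how messages are represented by choices (the injections phi) and on which
  zero symbols are erased; any such way of filling in the details is admitted.  The encoder for
  write 1 is only constrained on the all-zero state, the one for write i > 1 only on states with
  enough zero symbols; elsewhere, as for the decoder outside the codewords, the values are
  irrelevant.
\<close>

definition position_modulation_code ::
  "nat \<Rightarrow> (nat \<Rightarrow> nat) \<Rightarrow> (nat \<Rightarrow> nat) \<Rightarrow>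
   (nat \<Rightarrow> bool list \<Rightarrow> nat \<Rightarrow> bool list) \<Rightarrow> (bool list \<Rightarrow> nat) \<Rightarrow> bool"
where
  "position_modulation_code t h v E D \<longleftrightarrow>
     (\<forall>i\<in>{1..<t}. h (i + 1) < h i) \<and> 0 < h t \<and>
     (\<forall>i\<in>{1..t}. \<forall>x\<in>states (2 * h 1). \<forall>a<v i. E i x a \<in> states (2 * h 1)) \<and>
     (\<exists>\<phi> :: nat \<Rightarrow> nat \<Rightarrow> nat list.
        (\<forall>i\<in>{1..t}. inj_on (\<phi> i) {..<v i} \<and> \<phi> i ` {..<v i} \<subseteq> pm_choices t h i) \<and>
        (\<forall>a<v 1. symbols (E 1 (replicate (2 * h 1) False) a) = \<phi> 1 a) \<and>
        (\<forall>i\<in>{2..t}. \<forall>x\<in>states (2 * h 1). h i \<le> card (zero_symbols x) \<longrightarrow>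
           (\<forall>a<v i. pm_erase_write x (\<phi> i a) (E i x a))) \<and>
        (\<forall>x\<in>states (2 * h 1). \<forall>a<v (pm_write_number t h x).
           pm_read (pm_write_number t h x) x = \<phi> (pm_write_number t h x) a \<longrightarrow> D x = a))"

end

theory Submission
  imports Defs
begin

text \<open>
  Lower bound: in any womcode, let q be a lower bound on the number of zero wits needed for the
  writes after the current one.  The v states reachable from a state with m zero wits are
  distinct, since the decoder separates them, and each arises by setting at most m - q of the
  m wits.  Hence the sum of the binomials (m choose i) for i at most m - q is at least v, which
  says that m is at least q plus the value of delta at v and q.

  Comparison: a number of wits that satisfies this counting condition also suffices as a number
  of symbols in position modulation, because a changed symbol has at least two values.  So the
  recursion for h stays below the one for Z, and the two wits per symbol cost the factor 2.
\<close>

section \<open>The zero wits of a state\<close>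

definition zeros :: "bool list \<Rightarrow> nat set" where
  "zeros x = {j. j < length x \<and> \<not> x ! j}"

lemma finite_zeros [simp]: "finite (zeros x)"
  by (simp add: zeros_def)

lemma card_zeros_le: "card (zeros x) \<le> length x"
proof -
  have "zeros x \<subseteq> {..<length x}" by (auto simp: zeros_def)
  from card_mono[OF _ this] show ?thesis by simp
qed

lemma state_le_length: "state_le x y \<Longrightarrow> length y = length x"
  by (simp add: state_le_def list_all2_lengthD)

lemma zeros_antimono: "state_le x y \<Longrightarrow> zeros y \<subseteq> zeros x"
  by (auto simp: state_le_def zeros_def list_all2_conv_all_nth)

lemma zeros_inject:
  assumes "zeros x = zeros y" "length x = length y"
  shows "x = y"
proof (rule nth_equalityI)
  fix j assume "j < length x"
  moreover have "j \<in> zeros x \<longleftrightarrow> j \<in> zeros y" using assms(1) by simp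
  ultimately show "x ! j = y ! j" using assms(2) by (simp add: zeros_def)
qed fact

lemma card_small_subsets:
  assumes "finite Z"
  shows "card {T. T \<subseteq> Z \<and> card T \<le> d} = (\<Sum>i=0..d. card Z choose i)"
proof -
  have "{T. T \<subseteq> Z \<and> card T \<le> d} = (\<Union>i\<in>{0..d}. {T. T \<subseteq> Z \<and> card T = i})"
    by auto
  also have "card \<dots> = (\<Sum>i=0..d. card {T. T \<subseteq> Z \<and> card T = i})"
    using assms by (intro card_UN_disjoint) auto
  also have "\<dots> = (\<Sum>i=0..d. card Z choose i)"
    using assms by (simp add: n_subsets)
  finally show ?thesis .
qed

text \<open>A successor of \<open>x\<close> is determined by the set of wits newly set in it, and
  keeping \<open>q\<close> zero wits leaves at most \<open>card (zeros x) - q\<close> wits to set.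
  So the successors inject into the small subsets of \<open>zeros x\<close>.\<close>

lemma card_successors_le:
  assumes "\<And>y. y \<in> Y \<Longrightarrow> state_le x y \<and> q \<le> card (zeros y)"
  shows "card Y \<le> (\<Sum>i=0..card (zeros x) - q. card (zeros x) choose i)"
proof -
  let ?f = "\<lambda>y. zeros x - zeros y"
  have "inj_on ?f Y"
  proof (rule inj_onI)
    fix y z assume yz: "y \<in> Y" "z \<in> Y" "?f y = ?f z"
    have "zeros y \<subseteq> zeros x" "zeros z \<subseteq> zeros x" "length y = length z"
      using assms[OF yz(1)] assms[OF yz(2)] zeros_antimono state_le_length[of x y] state_le_length[of x z]
      by simp_all
    \<comment> \<open>Complementation within \<open>zeros x\<close> is an involution on its
      subsets.\<close>
    with yz(3) have "zeros y = zeros z" by (metis double_diff order_refl)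
    then show "y = z" using \<open>length y = length z\<close> by (rule zeros_inject)
  qed
  moreover have "?f ` Y \<subseteq> {T. T \<subseteq> zeros x \<and> card T \<le> card (zeros x) - q}"
  proof clarsimp
    fix y assume "y \<in> Y"
    from assms[OF this] have "zeros y \<subseteq> zeros x" "q \<le> card (zeros y)"
      by (auto dest: zeros_antimono)
    then show "card (zeros x - zeros y) \<le> card (zeros x) - q"
      by (simp add: card_Diff_subset)
  qed
  ultimately have "card Y \<le> card {T. T \<subseteq> zeros x \<and> card T \<le> card (zeros x) - q}"
    by (intro card_inj_on_le) simp_all
  then show ?thesis by (simp add: card_small_subsets)
qed

section \<open>The lower bound on the number of wits\<close>

text \<open>Puts the recursion into a form with an explicit offset, so that backward inductions on
  the write number can use it.\<close>

lemma wom_Z_shift_Suc: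
  "wom_Z (Suc k) (\<lambda>j. v (m + j)) =
    wom_Z k (\<lambda>j. v (Suc m + j)) + wom_delta (v (Suc m)) (wom_Z k (\<lambda>j. v (Suc m + j)))"
  by simp

text \<open>Lets the message of a later write vary while the current state stays fixed.\<close>

lemma written_state_cong:
  "(\<And>j. j \<in> {1..i} \<Longrightarrow> a j = b j) \<Longrightarrow> written_state n E a i = written_state n E b i"
  by (induction i) auto

text \<open>Backward induction on \<open>m\<close>, starting after the last write, where nothing
  remains to be stored. The messages \<open>a\<close> are generalised because the hypothesis is
  applied to every message that can be written next.\<close>

lemma wom_Z_le_card_zeros:
  assumes code: "womcode t v n E D" and v: "\<And>i. i \<in> {1..t} \<Longrightarrow> 0 < v i"
    and a: "\<And>i. i \<in> {1..t} \<Longrightarrow> a i < v i" and "m \<le> t"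
  shows "wom_Z (t - m) (\<lambda>j. v (m + j)) \<le> card (zeros (written_state n E a m))"
  using \<open>m \<le> t\<close> a
proof (induction arbitrary: a rule: inc_induct)
  case base
  then show ?case by simp
next
  case (step m)
  define x where "x = written_state n E a m"
  define q where "q = wom_Z (t - Suc m) (\<lambda>j. v (Suc m + j))"
  define y where "y b = written_state n E (a(Suc m := b)) (Suc m)" for b
  have ok: "state_le x (y b)" "D (y b) = b" "q \<le> card (zeros (y b))" if "b < v (Suc m)" for b
  proof -
    have valid: "(a(Suc m := b)) i < v i" if "i \<in> {1..t}" for i
      using step.prems[OF that] \<open>b < v (Suc m)\<close> by simp
    then have "\<forall>i\<in>{1..t}. (a(Suc m := b)) i < v i" by blast
    moreover have "Suc m \<in> {1..t}" using step.hyps by simp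
    ultimately have "state_le (written_state n E (a(Suc m := b)) (Suc m - 1)) (y b)
        \<and> D (y b) = (a(Suc m := b)) (Suc m)"
      using code unfolding womcode_def y_def by blast
    moreover have "written_state n E (a(Suc m := b)) m = x"
      unfolding x_def by (rule written_state_cong) auto
    ultimately show "state_le x (y b)" "D (y b) = b" by auto
    show "q \<le> card (zeros (y b))"
      unfolding q_def y_def by (rule step.IH) (rule valid)
  qed
  have "inj_on y {..<v (Suc m)}"
    by (rule inj_on_inverseI[of _ D]) (use ok in auto)
  then have "v (Suc m) = card (y ` {..<v (Suc m)})" by (simp add: card_image)
  also have "\<dots> \<le> (\<Sum>i=0..card (zeros x) - q. card (zeros x) choose i)"
    by (rule card_successors_le) (use ok in auto)
  finally have bound: "v (Suc m) \<le> (\<Sum>i=0..card (zeros x) - q. card (zeros x) choose i)" .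
  have v0: "0 < v (Suc m)" using v[of "Suc m"] step.hyps by simp
  \<comment> \<open>Message 0 is legal since \<open>v (Suc m)\<close> is positive. One successor is
    enough to see that \<open>card (zeros x) - q\<close> is a true difference, so that adding
    \<open>q\<close> gives back \<open>card (zeros x)\<close>.\<close>
  have "q \<le> card (zeros (y 0))" using ok(3) v0 by blast
  also have "\<dots> \<le> card (zeros x)" using zeros_antimono[OF ok(1)[OF v0]] by (simp add: card_mono)
  finally have "q \<le> card (zeros x)" .
  with bound have "wom_delta (v (Suc m)) q \<le> card (zeros x) - q"
    unfolding wom_delta_def by (intro Least_le) simp
  moreover have "t - m = Suc (t - Suc m)" using step.hyps by simp
  ultimately show ?case
    using \<open>q \<le> card (zeros x)\<close> unfolding x_def[symmetric]
    by (simp only: wom_Z_shift_Suc q_def[symmetric])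
qed

lemma wom_Z_le_length:
  assumes "womcode t v n E D" "\<And>i. i \<in> {1..t} \<Longrightarrow> 0 < v i"
  shows "wom_Z t v \<le> n"
proof -
  have "wom_Z (t - 0) (\<lambda>j. v (0 + j)) \<le> card (zeros (written_state n E (\<lambda>_. 0) 0))"
    by (rule wom_Z_le_card_zeros) (use assms in auto)
  also have "\<dots> \<le> length (written_state n E (\<lambda>_. 0) 0)" by (rule card_zeros_le)
  finally show ?thesis by simp
qed

section \<open>Position modulation needs at most as many symbols\<close>

text \<open>The term of index 1 alone is large enough. Hence \<open>v\<close> itself satisfies the
  condition under each of the minima (\<open>wom_delta\<close> and the increments of
  \<open>h\<close>), and these minima are attained.\<close>

lemma le_weighted_binomial_sum:
  assumes "c \<ge> 1" "l \<le> 1"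
  shows "v \<le> (\<Sum>k=l..v. ((q + v) choose k) * c ^ k)"
proof (cases "v = 0")
  case False
  have "v \<le> q + v" by simp
  also have "\<dots> \<le> ((q + v) choose 1) * c ^ 1" using assms by simp
  also have "\<dots> \<le> (\<Sum>k=l..v. ((q + v) choose k) * c ^ k)"
    by (rule member_le_sum) (use False assms in auto)
  finally show ?thesis .
qed simp

lemma wom_delta_sum_ge: "v \<le> (\<Sum>i=0..wom_delta v q. (q + wom_delta v q) choose i)"
  unfolding wom_delta_def
  by (rule LeastI[of _ v]) (use le_weighted_binomial_sum[of 1 0 v q] in simp)

text \<open>
  Leaving out the empty choice is compensated by the two values of each symbol: as
  q + delta \<ge> 1, doubling the term of index 1 already gains at least 1.
\<close>

lemma wom_delta_sum_pow2_ge: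
  fixes v q h :: nat
  defines "N \<equiv> q + wom_delta v q"
  assumes "h \<le> q" "2 \<le> v"
  shows "v \<le> (\<Sum>k=1..N - h. (N choose k) * 2 ^ k)"
proof -
  define d where "d = wom_delta v q"
  have sum: "v \<le> (\<Sum>i=0..d. N choose i)"
    using wom_delta_sum_ge[of v q] by (simp add: d_def N_def)
  have "d \<noteq> 0"
    using sum \<open>2 \<le> v\<close> by (auto intro: ccontr)
  \<comment> \<open>Writing S for the sum without its index 0, the chain is
    \<open>v \<le> 1 + S \<le> 2 * S\<close>, and the factor 2 is absorbed by the weights
    \<open>2 ^ k\<close>.\<close>
  have "v \<le> 1 + (\<Sum>i=1..d. N choose i)"
    using sum by (simp add: sum.atLeast_Suc_atMost)
  moreover have "1 \<le> (\<Sum>i=1..d. N choose i)"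
  proof -
    have "1 \<le> N choose 1" using \<open>d \<noteq> 0\<close> by (simp add: N_def d_def)
    also have "\<dots> \<le> (\<Sum>i=1..d. N choose i)"
      by (rule member_le_sum) (use \<open>d \<noteq> 0\<close> in auto)
    finally show ?thesis .
  qed
  moreover have "(\<Sum>i=1..d. N choose i) * 2 \<le> (\<Sum>k=1..d. (N choose k) * 2 ^ k)"
    unfolding sum_distrib_right
  proof (intro sum_mono mult_left_mono)
    fix k assume "k \<in> {1..d}"
    then show "(2::nat) \<le> 2 ^ k" by (cases k) auto
  qed simp
  \<comment> \<open>From \<open>h \<le> q\<close> it follows that \<open>d \<le> N - h\<close>, so
    the range only grows.\<close>
  moreover have "(\<Sum>k=1..d. (N choose k) * 2 ^ k) \<le> (\<Sum>k=1..N - h. (N choose k) * 2 ^ k)"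
    by (rule sum_mono2) (use \<open>h \<le> q\<close> in \<open>auto simp: N_def d_def\<close>)
  ultimately show ?thesis by linarith
qed

text \<open>Both sides are compared at the same total \<open>q + wom_delta v q\<close>: with the
  total fixed, a smaller reserve \<open>h\<close> leaves more symbols free to be changed.\<close>

lemma pm_middle_step_le:
  assumes "h \<le> q" "2 \<le> v"
  shows "h + (LEAST d. (\<Sum>k=1..d. ((h + d) choose k) * 2 ^ k) \<ge> v) \<le> q + wom_delta v q"
proof -
  have "(LEAST d. (\<Sum>k=1..d. ((h + d) choose k) * 2 ^ k) \<ge> v) \<le> q + wom_delta v q - h"
    by (rule Least_le) (use wom_delta_sum_pow2_ge[OF assms] assms in simp)
  with assms show ?thesis by linarith
qed

text \<open>The first write also admits the empty choice and has three values per symbol, so the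
  estimate with weight 2 is more than enough.\<close>

lemma pm_first_step_le:
  assumes "h \<le> q" "2 \<le> v"
  shows "h + (LEAST d. (\<Sum>k=0..d. ((h + d) choose k) * 3 ^ k) \<ge> v) \<le> q + wom_delta v q"
proof -
  define N where "N = q + wom_delta v q"
  have "v \<le> (\<Sum>k=1..N - h. (N choose k) * 2 ^ k)"
    unfolding N_def by (rule wom_delta_sum_pow2_ge[OF assms])
  also have "\<dots> \<le> (\<Sum>k=1..N - h. (N choose k) * 3 ^ k)"
    by (intro sum_mono mult_left_mono power_mono) auto
  also have "\<dots> \<le> (\<Sum>k=0..N - h. (N choose k) * 3 ^ k)"
    by (rule sum_mono2) auto
  finally have "(LEAST d. (\<Sum>k=0..d. ((h + d) choose k) * 3 ^ k) \<ge> v) \<le> N - h"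
    by (intro Least_le) (use assms in \<open>simp add: N_def\<close>)
  with assms show ?thesis by (simp add: N_def)
qed

text \<open>Replaces the real logarithm in the definition of \<open>h t\<close> by a comparison of
  natural numbers.\<close>

lemma ceiling_log_le_iff:
  fixes b :: nat
  assumes "2 \<le> b" "0 < n"
  shows "\<lceil>log (real b) (real n)\<rceil> \<le> int d \<longleftrightarrow> n \<le> b ^ d"
proof -
  have "\<lceil>log (real b) (real n)\<rceil> \<le> int d \<longleftrightarrow> log (real b) (real n) \<le> real d"
    by (simp add: ceiling_le_iff)
  also have "\<dots> \<longleftrightarrow> real n \<le> real b powr real d"
    using assms by (intro log_le_iff) auto
  also have "\<dots> \<longleftrightarrow> n \<le> b ^ d"
    using assms by (simp add: powr_realpow flip: of_nat_power)
  finally show ?thesis .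
qed

text \<open>Last write, \<open>d\<close> symbols against \<open>d\<close> wits: excluding the
  all-zero vector costs one of \<open>3 ^ d\<close> vectors, and at least \<open>2 ^ d\<close>
  remain once \<open>d\<close> is positive.\<close>

lemma Suc_pow2_le_pow3: "0 < d \<Longrightarrow> Suc (2 ^ d) \<le> 3 ^ d"
proof (induction d)
  case (Suc d)
  then show ?case by (cases "d = 0") auto
qed simp

text \<open>For \<open>q = 0\<close> the sum runs over a full row of Pascal's triangle.\<close>

lemma wom_delta_0_pow2_ge: "v \<le> 2 ^ wom_delta v 0"
  using wom_delta_sum_ge[of v 0] choose_row_sum[of "wom_delta v 0"]
  by (simp only: atMost_atLeast0 add_0)

section \<open>Counting the choices\<close>

lemma num_nonzero_Nil [simp]: "num_nonzero [] = 0"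
  by (simp add: num_nonzero_def)

lemma num_nonzero_Cons [simp]: "num_nonzero (a # c) = (if a = 0 then 0 else 1) + num_nonzero c"
  by (simp add: num_nonzero_def)

lemma num_nonzero_compl: "num_nonzero c + length (filter (\<lambda>s. s = 0) c) = length c"
  by (induction c) auto

lemma num_nonzero_eq_0: "num_nonzero c = 0 \<longleftrightarrow> c = replicate (length c) 0"
  by (induction c) auto

lemma finite_num_nonzero_lists:
  "finite A \<Longrightarrow> finite {c. length c = n \<and> set c \<subseteq> A \<and> P c}"
  by (rule finite_subset[OF _ finite_lists_length_eq[of A n]]) auto

text \<open>Split by the first entry: a zero head leaves all \<open>k\<close> nonzero entries to the
  tail, a nonzero head has \<open>card A\<close> values and leaves \<open>k - 1\<close>. Pascal's
  rule adds the two counts.\<close>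

lemma card_num_nonzero_eq:
  assumes "finite A" "0 \<notin> A"
  shows "card {c. length c = n \<and> set c \<subseteq> insert 0 A \<and> num_nonzero c = k} = (n choose k) * card A ^ k"
proof (induction n arbitrary: k)
  case 0
  have "{c::nat list. length c = 0 \<and> set c \<subseteq> insert 0 A \<and> num_nonzero c = k} = (if k = 0 then {[]} else {})"
    by auto
  then show ?case by (cases k) auto
next
  case (Suc n)
  let ?L = "\<lambda>n k. {c. length c = n \<and> set c \<subseteq> insert 0 A \<and> num_nonzero c = k}"
  have fin: "finite (?L n k)" for n k using assms by (intro finite_num_nonzero_lists) simp
  show ?case
  proof (cases k)
    case 0
    have "?L (Suc n) k = (#) 0 ` ?L n 0"
    proof (rule set_eqI)
      fix c
      show "c \<in> ?L (Suc n) k \<longleftrightarrow> c \<in> (#) 0 ` ?L n 0"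
      proof (cases c)
        case (Cons a b)
        show ?thesis
          using 0 by (cases "a = 0") (auto simp: Cons image_iff)
      qed auto
    qed
    then show ?thesis using Suc.IH[of 0] 0 by (simp add: card_image)
  next
    case (Suc k')
    let ?B = "(\<lambda>(a, c). a # c) ` (A \<times> ?L n k')"
    have split: "?L (Suc n) k = (#) 0 ` ?L n k \<union> ?B"
    proof (rule set_eqI)
      fix c
      show "c \<in> ?L (Suc n) k \<longleftrightarrow> c \<in> (#) 0 ` ?L n k \<union> ?B"
      proof (cases c)
        case (Cons a b)
        show ?thesis
          using Suc assms(2) by (cases "a = 0") (auto simp: Cons image_iff)
      qed auto
    qed
    have "card (?L (Suc n) k) = card ((#) 0 ` ?L n k) + card ?B"
      unfolding split
    proof (rule card_Un_disjoint)
      show "finite ((#) 0 ` ?L n k)" "finite ?B"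
        using assms(1) fin by (intro finite_imageI finite_cartesian_product; blast)+
      show "(#) 0 ` ?L n k \<inter> ?B = {}" using assms(2) by auto
    qed
    moreover have "card ((#) 0 ` ?L n k) = (n choose k) * card A ^ k"
      by (subst card_image) (simp_all only: inj_on_def list.inject Suc.IH simp_thms ball_simps)
    moreover have "card ?B = card A * ((n choose k') * card A ^ k')"
    proof -
      have "card ?B = card (A \<times> ?L n k')" by (rule card_image) (auto simp: inj_on_def)
      then show ?thesis by (simp only: card_cartesian_product Suc.IH)
    qed
    ultimately have "card (?L (Suc n) k) = (n choose k) * card A ^ k + card A * ((n choose k') * card A ^ k')"
      by (simp only:)
    then show ?thesis by (simp only: Suc binomial_Suc_Suc power_Suc add_mult_distrib) (simp only: ac_simps)
  qed
qed

lemma card_num_nonzero_in: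
  assumes "finite A" "0 \<notin> A" "finite K"
  shows "card {c. length c = n \<and> set c \<subseteq> insert 0 A \<and> num_nonzero c \<in> K} =
    (\<Sum>k\<in>K. (n choose k) * card A ^ k)"
proof -
  have "{c. length c = n \<and> set c \<subseteq> insert 0 A \<and> num_nonzero c \<in> K} =
     (\<Union>k\<in>K. {c. length c = n \<and> set c \<subseteq> insert 0 A \<and> num_nonzero c = k})"
    by auto
  also have "card \<dots> = (\<Sum>k\<in>K. card {c. length c = n \<and> set c \<subseteq> insert 0 A \<and> num_nonzero c = k})"
    using assms by (intro card_UN_disjoint ballI impI finite_num_nonzero_lists) auto
  finally show ?thesis by (simp add: card_num_nonzero_eq[OF assms(1,2)])
qed

lemma finite_pm_choices: "finite (pm_choices t h i)"
  by (auto simp: pm_choices_def finite_num_nonzero_lists)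

lemma card_pm_choices_first:
  "card (pm_choices t h 1) = (\<Sum>k=0..h 1 - h 2. (h 1 choose k) * 3 ^ k)"
proof -
  have "card {1, 2, 3::nat} = 3" by simp
  from card_num_nonzero_in[of "{1, 2, 3}" "{0..h 1 - h 2}" "h 1", unfolded this]
  show ?thesis by (simp add: pm_choices_def)
qed

lemma card_pm_choices_middle:
  assumes "1 < i" "i < t"
  shows "card (pm_choices t h i) = (\<Sum>k=1..h i - h (i + 1). (h i choose k) * 2 ^ k)"
proof -
  have "card {1, 2::nat} = 2" by simp
  from card_num_nonzero_in[of "{1, 2}" "{1..h i - h (i + 1)}" "h i", unfolded this]
  show ?thesis using assms by (simp add: pm_choices_def)
qed

lemma card_pm_choices_last:
  assumes "1 < t"
  shows "card (pm_choices t h t) = 3 ^ h t - 1"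
proof -
  have "pm_choices t h t = {c. set c \<subseteq> {0, 1, 2} \<and> length c = h t} - {replicate (h t) 0}"
    using assms by (auto simp: pm_choices_def)
  also have "card \<dots> = card {c. set c \<subseteq> {0, 1, 2::nat} \<and> length c = h t} - 1"
    by (rule card_Diff_singleton) auto
  also have "card {c. set c \<subseteq> {0, 1, 2::nat} \<and> length c = h t} = 3 ^ h t"
  proof -
    have "card {0, 1, 2::nat} = 3" by simp
    from card_lists_length_eq[of "{0, 1, 2::nat}" "h t", unfolded this]
    show ?thesis by simp
  qed
  finally show ?thesis .
qed

lemma pm_choices_first: "pm_choices t h 1 \<subseteq> {c. length c = h 1 \<and> set c \<subseteq> {0, 1, 2, 3}}"
  by (auto simp: pm_choices_def)

text \<open>A later choice changes at least one symbol, so the number of zero symbols drops below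
  \<open>h i\<close>. This drop is what reveals the write number.\<close>

lemma pm_choices_not_first:
  assumes "1 < i" "i \<le> t"
  shows "pm_choices t h i \<subseteq> {c. length c = h i \<and> set c \<subseteq> {0, 1, 2} \<and> length (filter (\<lambda>s. s = 0) c) < h i}"
proof
  fix c assume c: "c \<in> pm_choices t h i"
  have len: "length c = h i" "set c \<subseteq> {0, 1, 2}"
    using c assms by (auto simp: pm_choices_def split: if_splits)
  moreover have "num_nonzero c \<noteq> 0"
  proof (cases "i < t")
    case True
    then show ?thesis using c assms by (simp add: pm_choices_def)
  next
    case False
    then have "c \<noteq> replicate (h i) 0" using c assms by (simp add: pm_choices_def)
    then show ?thesis by (simp add: num_nonzero_eq_0 len)
  qed
  ultimately show "c \<in> {c. length c = h i \<and> set c \<subseteq> {0, 1, 2} \<and> length (filter (\<lambda>s. s = 0) c) < h i}"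
    using num_nonzero_compl[of c] by simp
qed

text \<open>The cap on changed symbols is exactly what reserves enough zero symbols for the next
  write.\<close>

lemma pm_choices_not_last:
  assumes "c \<in> pm_choices t h i" "i < t" "h (i + 1) < h i" "1 \<le> i"
  shows "h (i + 1) \<le> length (filter (\<lambda>s. s = 0) c)"
proof -
  have "length c = h i \<and> num_nonzero c \<le> h i - h (i + 1)"
  proof (cases "i = 1")
    case True
    with assms(1) have "c \<in> pm_choices t h 1" by simp
    then show ?thesis unfolding True one_add_one by (simp add: pm_choices_def)
  next
    case False
    with assms(1,2) show ?thesis by (simp add: pm_choices_def)
  qed
  then show ?thesis using num_nonzero_compl[of c] assms by linarith
qed

section \<open>States and their symbols\<close>

text \<open>Right inverse of \<open>symbols\<close> for values up to 3: even wits hold the low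
  binary digit, odd wits the high one.\<close>

definition bits :: "nat list \<Rightarrow> bool list" where
  "bits s = map (\<lambda>p. if even p then odd (s ! (p div 2)) else 2 \<le> s ! (p div 2)) [0..<2 * length s]"

lemma length_bits [simp]: "length (bits s) = 2 * length s"
  by (simp add: bits_def)

lemma length_symbols [simp]: "length (symbols x) = length x div 2"
  by (simp add: symbols_def)

lemma nth_symbols:
  "j < length x div 2 \<Longrightarrow> symbols x ! j = of_bool (x ! (2 * j)) + 2 * of_bool (x ! (2 * j + 1))"
  by (simp add: symbols_def)

lemma symbols_bits:
  assumes "set s \<subseteq> {0, 1, 2, 3}"
  shows "symbols (bits s) = s"
proof (rule nth_equalityI)
  fix j assume "j < length (symbols (bits s))"
  then have j: "j < length s" by simp
  then have "s ! j \<in> {0, 1, 2, 3}" using assms nth_mem by blast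
  then show "symbols (bits s) ! j = s ! j"
    using j by (auto simp: nth_symbols bits_def)
qed simp

section \<open>Erasing and writing symbols: existence, reading back, monotonicity\<close>

lemma card_zero_symbols: "card (zero_symbols x) = length (filter (\<lambda>s. s = 0) (symbols x))"
  by (simp add: zero_symbols_def length_filter_conv_card)

text \<open>Induction from the front: position 0 takes the head of \<open>c\<close> if it lies in
  \<open>S\<close> and \<open>z\<close> otherwise; the rest of \<open>S\<close> moves down by
  one.\<close>

lemma ex_nths_eq:
  assumes "card (S \<inter> {..<n}) = length c"
  shows "\<exists>l. length l = n \<and> nths l S = c \<and> (\<forall>j<n. j \<notin> S \<longrightarrow> l ! j = z)"
  using assms
proof (induction n arbitrary: S c)
  case 0
  then show ?case by simp
next
  case (Suc n)
  let ?S = "{j. Suc j \<in> S}"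
  have split: "S \<inter> {..<Suc n} = (if 0 \<in> S then {0} else {}) \<union> Suc ` (?S \<inter> {..<n})"
  proof (rule set_eqI)
    fix j
    show "j \<in> S \<inter> {..<Suc n} \<longleftrightarrow> j \<in> (if 0 \<in> S then {0} else {}) \<union> Suc ` (?S \<inter> {..<n})"
      by (cases j) auto
  qed
  have card: "length c = (if 0 \<in> S then 1 else 0) + card (?S \<inter> {..<n})"
    unfolding Suc.prems[symmetric] split by (auto simp: card_image)
  show ?case
  proof (cases "0 \<in> S")
    case True
    with card obtain b c' where c: "c = b # c'" "length c' = card (?S \<inter> {..<n})"
      by (cases c) auto
    from Suc.IH[OF c(2)[symmetric]] obtain l
      where "length l = n" "nths l ?S = c'" "\<forall>j<n. j \<notin> ?S \<longrightarrow> l ! j = z" by blast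
    then have "length (b # l) = Suc n \<and> nths (b # l) S = c \<and> (\<forall>j<Suc n. j \<notin> S \<longrightarrow> (b # l) ! j = z)"
      using True c by (auto simp: nths_Cons nth_Cons split: nat.splits)
    then show ?thesis by blast
  next
    case False
    with card Suc.IH[of ?S c] obtain l
      where "length l = n" "nths l ?S = c" "\<forall>j<n. j \<notin> ?S \<longrightarrow> l ! j = z" by auto
    then have "length (z # l) = Suc n \<and> nths (z # l) S = c \<and> (\<forall>j<Suc n. j \<notin> S \<longrightarrow> (z # l) ! j = z)"
      using False by (auto simp: nths_Cons nth_Cons split: nat.splits)
    then show ?thesis by blast
  qed
qed

lemma ex_pm_erase_write:
  assumes "even (length x)" "length c \<le> card (zero_symbols x)" "set c \<subseteq> {0, 1, 2, 3}"
  shows "\<exists>y. pm_erase_write x c y"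
proof -
  from assms(2) obtain S where S: "S \<subseteq> zero_symbols x" "card S = length c"
    by (meson obtain_subset_with_card_n)
  define n where "n = length x div 2"
  have "S \<inter> {..<n} = S" using S by (auto simp: zero_symbols_def n_def)
  with S ex_nths_eq[of S n c 3] obtain l
    where l: "length l = n" "nths l S = c" "\<forall>j<n. j \<notin> S \<longrightarrow> l ! j = 3" by auto
  have "set l \<subseteq> {0, 1, 2, 3}"
  proof
    fix b assume "b \<in> set l"
    then obtain j where j: "j < n" "b = l ! j" using l by (auto simp: in_set_conv_nth)
    show "b \<in> {0, 1, 2, 3}"
    proof (cases "j \<in> S")
      case True
      then have "b \<in> set (nths l S)" using j l(1) by (auto simp: set_nths)
      then show ?thesis using l(2) assms(3) by auto
    qed (use j l in auto)
  qed
  then have "symbols (bits l) = l" by (rule symbols_bits)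
  \<comment> \<open>Since \<open>length x\<close> is even, \<open>bits l\<close> has the same length
    as \<open>x\<close>.\<close>
  then have "pm_erase_write x c (bits l)"
    using S l assms(1) by (auto simp: pm_erase_write_def n_def)
  then show ?thesis ..
qed

text \<open>As \<open>c\<close> never uses the erased value, the symbols different from 3 sit
  exactly on \<open>S\<close>. So the vector can be read without knowing which positions were
  chosen.\<close>

lemma pm_erase_write_filter:
  assumes "pm_erase_write x c y" "3 \<notin> set c"
  shows "filter (\<lambda>s. s \<noteq> 3) (symbols y) = c"
proof -
  from assms(1) obtain S where S: "\<forall>j<length (symbols y). j \<notin> S \<longrightarrow> symbols y ! j = 3"
    "nths (symbols y) S = c"
    by (auto simp: pm_erase_write_def)
  have mem: "j \<in> S \<longleftrightarrow> symbols y ! j \<noteq> 3" if "j < length (symbols y)" for j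
  proof
    assume "j \<in> S"
    then have "symbols y ! j \<in> set (nths (symbols y) S)" using that by (auto simp: set_nths)
    then show "symbols y ! j \<noteq> 3" using S(2) assms(2) by auto
  qed (use S(1) that in blast)
  have "filter (\<lambda>s. s \<noteq> 3) (symbols y) = nths (symbols y) {i. i < length (symbols y) \<and> symbols y ! i \<noteq> 3}"
    by (rule filter_eq_nths)
  \<comment> \<open>\<open>nths\<close> inspects only indices below the length, where the two sets
    agree.\<close>
  also have "\<dots> = nths (symbols y) S"
    unfolding nths_def by (rule arg_cong[where f = "map fst"], rule filter_cong)
      (auto simp: mem set_zip)
  finally show ?thesis using S(2) by simp
qed

lemma pm_erase_write_card_zeros:
  assumes "pm_erase_write x c y" "3 \<notin> set c"
  shows "card (zero_symbols y) = length (filter (\<lambda>s. s = 0) c)"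
proof -
  have "filter (\<lambda>s. s = 0) c = filter (\<lambda>s. s = 0) (symbols y)"
    unfolding pm_erase_write_filter[OF assms, symmetric] filter_filter
    by (rule filter_cong) auto
  then show ?thesis by (simp add: card_zero_symbols)
qed

text \<open>On \<open>S\<close> both wits of \<open>x\<close> are still zero; off \<open>S\<close>
  both wits of \<open>y\<close> are set.\<close>

lemma pm_erase_write_state_le:
  assumes "pm_erase_write x c y" "even (length x)"
  shows "state_le x y"
  unfolding state_le_def list_all2_conv_all_nth
proof (intro conjI allI impI)
  from assms(1) obtain S where S: "S \<subseteq> zero_symbols x"
    "\<forall>j<length (symbols y). j \<notin> S \<longrightarrow> symbols y ! j = 3" and len: "length y = length x"
    by (auto simp: pm_erase_write_def)
  show "length x = length y" using len by simp
  fix p assume p: "p < length x"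
  define j where "j = p div 2"
  have j: "j < length x div 2" using p assms(2) by (auto simp: j_def)
  have pj: "p = 2 * j \<or> p = 2 * j + 1" by (auto simp: j_def)
  show "x ! p \<le> y ! p"
  proof (cases "j \<in> S")
    case True
    then have "symbols x ! j = 0" using S(1) by (auto simp: zero_symbols_def)
    then have "\<not> x ! p" using pj j by (auto simp: nth_symbols)
    then show ?thesis by simp
  next
    case False
    then have "symbols y ! j = 3" using S(2) j len by simp
    then have "y ! p" using pj j len by (auto simp: nth_symbols of_bool_def split: if_splits)
    then show ?thesis by simp
  qed
qed

section \<open>Position modulation codes are womcodes\<close>

lemma pm_parameters_antimono:
  fixes h :: "nat \<Rightarrow> nat"
  assumes "\<forall>i\<in>{1..<t}. h (i + 1) < h i" "i \<le> j" "1 \<le> i" "j \<le> t"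
  shows "h j \<le> h i"
  using assms(2,4)
proof (induction rule: dec_induct)
  case (step n)
  have "h (n + 1) < h n" using assms(1,3) step by simp
  then show ?case using step by simp
qed simp

text \<open>Since \<open>h\<close> decreases, the indices counted form an initial segment of
  \<open>{2..t}\<close>; the two bounds make it end at \<open>i\<close>.\<close>

lemma pm_write_number_eq:
  assumes decr: "\<forall>i\<in>{1..<t}. h (i + 1) < h i" and i: "i \<in> {1..t}"
    and lower: "i < t \<Longrightarrow> h (i + 1) \<le> card (zero_symbols x)"
    and upper: "1 < i \<Longrightarrow> card (zero_symbols x) < h i"
  shows "pm_write_number t h x = i"
proof -
  have "{j\<in>{2..t}. card (zero_symbols x) < h j} = {2..i}"
  proof (intro set_eqI iffI)
    fix j assume j: "j \<in> {j\<in>{2..t}. card (zero_symbols x) < h j}"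
    show "j \<in> {2..i}"
    proof (rule ccontr)
      assume "j \<notin> {2..i}"
      then have "i + 1 \<le> j" "j \<le> t" using j by auto
      with pm_parameters_antimono[OF decr, of "i + 1" j] lower j show False by simp
    qed
  next
    fix j assume j: "j \<in> {2..i}"
    with pm_parameters_antimono[OF decr, of j i] upper i
    show "j \<in> {j\<in>{2..t}. card (zero_symbols x) < h j}" by simp
  qed
  then show ?thesis using i by (simp add: pm_write_number_def)
qed

lemma position_modulation_womcode:
  assumes "t \<ge> 2" and code: "position_modulation_code t h v E D"
  shows "womcode t v (2 * h 1) E D"
proof -
  define n where "n = 2 * h 1"
  from code have decr: "\<forall>i\<in>{1..<t}. h (i + 1) < h i"
    and states: "\<forall>i\<in>{1..t}. \<forall>x\<in>states n. \<forall>a<v i. E i x a \<in> states n"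
    by (auto simp: position_modulation_code_def n_def)
  from code[unfolded position_modulation_code_def, folded n_def] obtain \<phi> where
    phi: "\<forall>i\<in>{1..t}. inj_on (\<phi> i) {..<v i} \<and> \<phi> i ` {..<v i} \<subseteq> pm_choices t h i"
    and first: "\<forall>a<v 1. symbols (E 1 (replicate n False) a) = \<phi> 1 a"
    and later: "\<forall>i\<in>{2..t}. \<forall>x\<in>states n. h i \<le> card (zero_symbols x) \<longrightarrow>
           (\<forall>a<v i. pm_erase_write x (\<phi> i a) (E i x a))"
    and decode: "\<forall>x\<in>states n. \<forall>a<v (pm_write_number t h x).
           pm_read (pm_write_number t h x) x = \<phi> (pm_write_number t h x) a \<longrightarrow> D x = a"
    by (elim conjE exE) (rule that)
  have choice: "\<phi> i a \<in> pm_choices t h i" if "i \<in> {1..t}" "a < v i" for i a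
    using phi that by blast
  have main: "state_le (written_state n E a (i - 1)) (written_state n E a i) \<and>
        D (written_state n E a i) = a i"
    if a: "\<forall>i\<in>{1..t}. a i < v i" and i: "i \<in> {1..t}" for a i
  proof -
    let ?x = "written_state n E a"
    \<comment> \<open>The claim is strengthened by an invariant: enough zero symbols remain for the
      next write. Only on such states is the next encoder constrained.\<close>
    have "?x i \<in> states n \<and> (i < t \<longrightarrow> h (i + 1) \<le> card (zero_symbols (?x i))) \<and>
      state_le (?x (i - 1)) (?x i) \<and> D (?x i) = a i"
      if "1 \<le> i" "i \<le> t" for i
      using that
    proof (induction rule: dec_induct)
      case base
      define y where "y = ?x 1"
      have y: "y = E 1 (replicate n False) (a 1)" by (simp add: y_def)
      have a1: "a 1 < v 1" using a \<open>t \<ge> 2\<close> by simp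
      have yn: "y \<in> states n"
        using states a1 \<open>t \<ge> 2\<close> unfolding y by (auto simp: states_def)
      have sym: "symbols y = \<phi> 1 (a 1)" using first a1 y by simp
      have "\<phi> 1 (a 1) \<in> pm_choices t h 1" using choice[of 1] a1 \<open>t \<ge> 2\<close> by simp
      then have "h (1 + 1) \<le> length (filter (\<lambda>s. s = 0) (symbols y))"
        unfolding sym by (rule pm_choices_not_last) (use decr \<open>t \<ge> 2\<close> in auto)
      then have z: "h (1 + 1) \<le> card (zero_symbols y)" by (simp add: card_zero_symbols)
      \<comment> \<open>For write 1 the upper bound on the zero symbols is vacuous.\<close>
      then have "pm_write_number t h y = 1"
        by (intro pm_write_number_eq[OF decr]) (use \<open>t \<ge> 2\<close> in auto)
      then have "D y = a 1"
        using decode yn a1 sym by (simp add: pm_read_def)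
      moreover have "state_le (replicate n False) y"
        using yn by (auto simp: state_le_def list_all2_conv_all_nth states_def)
      ultimately show ?case
        using yn z by (simp add: y_def)
    next
      case (step m)
      define x where "x = ?x m"
      define y where "y = ?x (Suc m)"
      define c where "c = \<phi> (Suc m) (a (Suc m))"
      have y: "y = E (Suc m) x (a (Suc m))" by (simp add: x_def y_def)
      have xn: "x \<in> states n" and zx: "h (Suc m) \<le> card (zero_symbols x)"
        using step by (auto simp: x_def)
      have am: "a (Suc m) < v (Suc m)" using a step.prems by simp
      have yn: "y \<in> states n" using states xn am step.prems unfolding y by simp
      have written: "pm_erase_write x c y"
        using later xn zx am step.prems step.hyps unfolding y c_def by simp
      have c: "c \<in> pm_choices t h (Suc m)" using choice[OF _ am] step.prems by (simp add: c_def)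
      have c': "3 \<notin> set c" "length (filter (\<lambda>s. s = 0) c) < h (Suc m)"
        using subsetD[OF pm_choices_not_first c] step.prems step.hyps by auto
      have zy: "h (Suc m + 1) \<le> card (zero_symbols y)" if "Suc m < t"
        unfolding pm_erase_write_card_zeros[OF written c'(1)]
        by (rule pm_choices_not_last[OF c]) (use decr that in auto)
      have "pm_write_number t h y = Suc m"
        by (rule pm_write_number_eq[OF decr])
          (use step.prems zy c' pm_erase_write_card_zeros[OF written c'(1)] in auto)
      then have "D y = a (Suc m)"
        using decode yn am pm_erase_write_filter[OF written c'(1)] step.hyps
        by (auto simp: pm_read_def c_def)
      moreover have "state_le x y"
        by (rule pm_erase_write_state_le[OF written]) (use xn in \<open>simp add: states_def n_def\<close>)
      ultimately show ?case using yn zy by (simp add: x_def y_def)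
    qed
    with i show ?thesis by simp
  qed
  show ?thesis
    unfolding womcode_def n_def[symmetric] using states main by blast
qed

text \<open>The cardinalities give injections of messages into choices; the choices of zero symbols
  and the decoder are then filled in by description operators.\<close>

lemma ex_position_modulation_code:
  assumes "t \<ge> 2" and decr: "\<forall>i\<in>{1..<t}. h (i + 1) < h i" and pos: "0 < h t"
    and size: "\<And>i. i \<in> {1..t} \<Longrightarrow> v i \<le> card (pm_choices t h i)"
  shows "\<exists>E D. position_modulation_code t h v E D"
proof -
  have "\<exists>f. inj_on f {..<v i} \<and> f ` {..<v i} \<subseteq> pm_choices t h i" if "i \<in> {1..t}" for i
    using card_le_inj[of "{..<v i}" "pm_choices t h i"] size[OF that] finite_pm_choices by auto
  then obtain \<phi> where inj: "\<And>i. i \<in> {1..t} \<Longrightarrow> inj_on (\<phi> i) {..<v i}"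
    and choice: "\<And>i. i \<in> {1..t} \<Longrightarrow> \<phi> i ` {..<v i} \<subseteq> pm_choices t h i"
    by metis
  \<comment> \<open>If too few zero symbols remain, returning \<open>x\<close> merely keeps the
    result among the states.\<close>
  define E where "E i x a =
    (if i = 1 then bits (\<phi> 1 a)
     else if h i \<le> card (zero_symbols x) then SOME y. pm_erase_write x (\<phi> i a) y else x)"
    for i :: nat and x a
  define D where "D x = (let i = pm_write_number t h x in THE a. a < v i \<and> \<phi> i a = pm_read i x)"
    for x
  have first: "length (\<phi> 1 a) = h 1" "set (\<phi> 1 a) \<subseteq> {0, 1, 2, 3}" if "a < v 1" for a
  proof -
    have "\<phi> 1 a \<in> pm_choices t h 1" using choice[of 1] \<open>t \<ge> 2\<close> that by auto
    with pm_choices_first show "length (\<phi> 1 a) = h 1" "set (\<phi> 1 a) \<subseteq> {0, 1, 2, 3}" by blast+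
  qed
  have written: "pm_erase_write x (\<phi> i a) (E i x a)"
    if "i \<in> {2..t}" "x \<in> states (2 * h 1)" "h i \<le> card (zero_symbols x)" "a < v i" for i x a
  proof -
    have "\<phi> i a \<in> pm_choices t h i" using choice[of i] that by auto
    with pm_choices_not_first[of i t h] that(1)
    have "length (\<phi> i a) = h i" "set (\<phi> i a) \<subseteq> {0, 1, 2}" by auto
    with that have "\<exists>y. pm_erase_write x (\<phi> i a) y"
      by (intro ex_pm_erase_write) (auto simp: states_def)
    then have "pm_erase_write x (\<phi> i a) (SOME y. pm_erase_write x (\<phi> i a) y)" by (rule someI_ex)
    with that show ?thesis by (simp add: E_def)
  qed
  have states: "E i x a \<in> states (2 * h 1)"
    if "i \<in> {1..t}" "x \<in> states (2 * h 1)" "a < v i" for i x a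
  proof (cases "i \<noteq> 1 \<and> h i \<le> card (zero_symbols x)")
    case True
    then show ?thesis
      using written[of i x a] that by (auto simp: pm_erase_write_def states_def)
  next
    case False
    then show ?thesis using that first by (auto simp: E_def states_def)
  qed
  have decode: "D x = a"
    if "a < v (pm_write_number t h x)"
      "pm_read (pm_write_number t h x) x = \<phi> (pm_write_number t h x) a" for x a
  proof -
    define i where "i = pm_write_number t h x"
    \<comment> \<open>At most \<open>t - 1\<close> indices are counted, so every state has a write
      number in \<open>{1..t}\<close>, and injectivity of \<open>\<phi>\<close> makes the decoded
      message unique.\<close>
    have "card {j\<in>{2..t}. card (zero_symbols x) < h j} \<le> card {2..t}"
      by (rule card_mono) auto
    then have "i \<in> {1..t}" using \<open>t \<ge> 2\<close> by (simp add: i_def pm_write_number_def)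
    from inj[OF this] have "(THE a. a < v i \<and> \<phi> i a = pm_read i x) = a"
      using that by (intro the_equality) (auto simp: i_def inj_on_def)
    then show ?thesis by (simp add: D_def i_def Let_def)
  qed
  have "position_modulation_code t h v E D"
    unfolding position_modulation_code_def
  proof (intro conjI exI[of _ \<phi>])
    show "\<forall>a<v 1. symbols (E 1 (replicate (2 * h 1) False) a) = \<phi> 1 a"
      using first by (simp add: E_def symbols_bits)
    show "\<forall>i\<in>{1..t}. \<forall>x\<in>states (2 * h 1). \<forall>a<v i. E i x a \<in> states (2 * h 1)"
      using states by simp
    show "\<forall>i\<in>{1..t}. inj_on (\<phi> i) {..<v i} \<and> \<phi> i ` {..<v i} \<subseteq> pm_choices t h i"
      using inj choice by simp
    show "\<forall>i\<in>{2..t}. \<forall>x\<in>states (2 * h 1). h i \<le> card (zero_symbols x) \<longrightarrow>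
           (\<forall>a<v i. pm_erase_write x (\<phi> i a) (E i x a))"
      using written by simp
    show "\<forall>x\<in>states (2 * h 1). \<forall>a<v (pm_write_number t h x).
           pm_read (pm_write_number t h x) x = \<phi> (pm_write_number t h x) a \<longrightarrow> D x = a"
      using decode by blast
  qed (fact decr pos)+
  then show ?thesis by blast
qed

section \<open>The given parameters: sizes, the code, and the chain from \<open>h 1\<close> to
  \<open>wom_w t v\<close>\<close>

theorem theorem2:
  fixes t :: nat and v h :: "nat \<Rightarrow> nat"
  assumes t: "t \<ge> 2"
    and v: "\<And>i. i \<in> {1..t} \<Longrightarrow> v i \<ge> 2"
    and h_last: "int (h t) = \<lceil>log 2 (real (v t) + 1) / log 2 3\<rceil>"
    and h_middle: "\<And>i. 1 < i \<Longrightarrow> i < t \<Longrightarrow>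
      h i = h (i + 1) + (LEAST d. (\<Sum>k=1..d. ((h (i + 1) + d) choose k) * 2 ^ k) \<ge> v i)"
    and h_first: "h 1 = h 2 + (LEAST d. (\<Sum>k=0..d. ((h 2 + d) choose k) * 3 ^ k) \<ge> v 1)"
  shows "h 1 \<le> wom_Z t v \<and> wom_Z t v \<le> wom_w t v \<and>
    (\<exists>E D. position_modulation_code t h v E D) \<and>
    (\<forall>E D. position_modulation_code t h v E D \<longrightarrow> womcode t v (2 * h 1) E D) \<and>
    wom_rate t v (2 * h 1) \<ge> 1 / 2 * wom_optimal_rate t v"
proof -
  have "log 2 (real (v t) + 1) / log 2 3 = log (real 3) (real (v t + 1))"
    by (simp add: log_def)
  with h_last have h_t: "\<lceil>log (real 3) (real (v t + 1))\<rceil> = int (h t)" by simp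
  have h_last_le: "h t \<le> d \<longleftrightarrow> v t + 1 \<le> 3 ^ d" for d
    using ceiling_log_le_iff[of 3 "v t + 1" d] unfolding h_t of_nat_le_iff by simp
  have h_t_size: "v t + 1 \<le> 3 ^ h t" using h_last_le[of "h t"] by simp

  have size_middle: "v i \<le> (\<Sum>k=1..h i - h (i + 1). (h i choose k) * 2 ^ k)"
    if "1 < i" "i < t" for i
  proof -
    define d where "d = (LEAST d. (\<Sum>k=1..d. ((h (i + 1) + d) choose k) * 2 ^ k) \<ge> v i)"
    have "(\<Sum>k=1..d. ((h (i + 1) + d) choose k) * 2 ^ k) \<ge> v i"
      unfolding d_def by (rule LeastI[of _ "v i"]) (rule le_weighted_binomial_sum; simp)
    then show ?thesis using h_middle[OF that, folded d_def] by simp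
  qed
  have size_first: "v 1 \<le> (\<Sum>k=0..h 1 - h 2. (h 1 choose k) * 3 ^ k)"
  proof -
    define d where "d = (LEAST d. (\<Sum>k=0..d. ((h 2 + d) choose k) * 3 ^ k) \<ge> v 1)"
    have "(\<Sum>k=0..d. ((h 2 + d) choose k) * 3 ^ k) \<ge> v 1"
      unfolding d_def by (rule LeastI[of _ "v 1"]) (rule le_weighted_binomial_sum; simp)
    then show ?thesis using h_first[folded d_def] by simp
  qed
  have v1: "2 \<le> v 1" and vt: "2 \<le> v t" using v t by simp_all
  have pos: "0 < h t" using h_last_le[of 0] vt by auto
  \<comment> \<open>With increment 0 the sum would be empty in a middle write and equal to 1 in the
    first, contradicting \<open>v i \<ge> 2\<close>.\<close>
  have decr: "\<forall>i\<in>{1..<t}. h (i + 1) < h i"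
  proof
    fix i assume i: "i \<in> {1..<t}"
    show "h (i + 1) < h i"
    proof (cases "i = 1")
      case True
      have "h 1 - h 2 \<noteq> 0"
      proof
        assume "h 1 - h 2 = 0"
        with size_first v1 show False by simp
      qed
      with True show ?thesis by (simp add: numeral_2_eq_2)
    next
      case False
      with i have "1 < i" "i < t" by auto
      from size_middle[OF this] v[of i] i have "h i - h (i + 1) \<noteq> 0"
        by (intro notI) simp
      then show ?thesis by simp
    qed
  qed
  have size: "v i \<le> card (pm_choices t h i)" if i: "i \<in> {1..t}" for i
  proof -
    consider "i = 1" | "1 < i" "i < t" | "i = t" "1 < t" using i t by (fastforce simp: le_less)
    then show ?thesis
    proof cases
      case 1
      then show ?thesis using size_first card_pm_choices_first by simp
    next
      case 2
      then show ?thesis using size_middle card_pm_choices_middle by simp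
    next
      case 3
      then show ?thesis using h_t_size card_pm_choices_last[of t h] by simp
    qed
  qed

  have ex: "\<exists>E D. position_modulation_code t h v E D"
    by (rule ex_position_modulation_code[OF t decr pos size])
  have womcode: "womcode t v (2 * h 1) E D" if "position_modulation_code t h v E D" for E D
    by (rule position_modulation_womcode[OF t that])

  \<comment> \<open>Backward induction from the last write. It stops at \<open>m = 1\<close>, that
    is at \<open>h 2\<close>, because \<open>h 1\<close> obeys a different recursion.\<close>
  have h_le_Z: "h (Suc m) \<le> wom_Z (t - m) (\<lambda>j. v (m + j))" if "1 \<le> m" "m \<le> t - 1" for m
    using that(2,1)
  proof (induction rule: inc_induct)
    case base
    define d where "d = wom_delta (v t) 0"
    have "v t \<le> 2 ^ d" unfolding d_def by (rule wom_delta_0_pow2_ge)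
    moreover from this have "0 < d" using vt by (cases d) auto
    ultimately have "v t + 1 \<le> 3 ^ d" using Suc_pow2_le_pow3[of d] by simp
    then have "h t \<le> d" by (simp add: h_last_le)
    moreover have "t - (t - 1) = Suc 0" "Suc (t - 1) = t" using t by simp_all
    ultimately show ?case by (simp only: wom_Z_shift_Suc) (simp add: d_def)
  next
    case (step m)
    have "t - m = Suc (t - Suc m)" "1 < Suc m" "Suc m < t" "2 \<le> v (Suc m)"
      using step v[of "Suc m"] by auto
    with step pm_middle_step_le[of "h (Suc (Suc m))"] h_middle[of "Suc m"] show ?case
      by (simp only: wom_Z_shift_Suc) simp
  qed
  have Z: "h 1 \<le> wom_Z t v"
  proof -
    have "h 2 \<le> wom_Z (t - 1) (\<lambda>j. v (Suc j))"
      using h_le_Z[of 1] t by (simp add: numeral_2_eq_2)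
    from pm_first_step_le[OF this v1] show ?thesis
      using t unfolding h_first by (cases t) auto
  qed
  have W: "wom_Z t v \<le> wom_w t v"
  proof -
    \<comment> \<open>The least number of wits is attained only if some womcode exists; position
      modulation provides one.\<close>
    from ex womcode have "\<exists>n E D. womcode t v n E D" by blast
    then have "\<exists>E D. womcode t v (wom_w t v) E D" unfolding wom_w_def by (rule LeastI_ex)
    then obtain E D where "womcode t v (wom_w t v) E D" by blast
    then show ?thesis by (rule wom_Z_le_length) (use v in force)
  qed
  have "0 < h 1"
    using pm_parameters_antimono[OF decr, of 1 t] pos t by simp
  have "1 \<le> (\<Prod>i=1..t. real (v i))"
    by (rule prod_ge_1) (use v in force)
  then have "0 \<le> log 2 (\<Prod>i=1..t. real (v i))" by simp
  \<comment> \<open>The numerator is nonnegative, and \<open>0 < h 1 \<le> wom_w t v\<close> makes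
    both denominators positive.\<close>
  then have "log 2 (\<Prod>i=1..t. real (v i)) / (2 * wom_w t v) \<le> log 2 (\<Prod>i=1..t. real (v i)) / (2 * h 1)"
    using Z W \<open>0 < h 1\<close> by (intro divide_left_mono) auto
  then have "wom_rate t v (2 * h 1) \<ge> 1 / 2 * wom_optimal_rate t v"
    by (simp add: wom_rate_def wom_optimal_rate_def)
  with Z W ex womcode show ?thesis by blast
qed

end
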